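(* For every integer $m>1$, $\chi_{cf}(G_m)\ge \chi_{um}(G_{\lfloor m/2\rfloor})$.
   Context: $G_m$ is the $m\times m$ grid graph: vertex set $\{0,\dots,m-1\}^2$, with $(x_1,y_1)$ and $(x_2,y_2)$ adjacent iff $|x_1-x_2|+|y_1-y_2|=1$. A path is a simple path (a single vertex counts). A unique-maximum coloring of a graph with $k$ colors is a map from vertices to $\{1,\dots,k\}$ such that on every path the maximum color occurs exactly once; $\chi_{um}$ is the minimum such $k$. A conflict-free coloring with $k$ colors is a map to $\{1,\dots,k\}$ such that on every path some color occurs exactly once; $\chi_{cf}$ is the minimum such $k$. *)

theory Defs
  imports
    "HOL-Library.FuncSet"
    "Graph_Theory.Digraph"
    "Graph_Theory.Pair_Digraph"
    "Graph_Theory.Vertex_Walk"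
begin

text \<open>
  An undirected graph is represented as a symmetric loop-free digraph, and a path by its
  list of vertices (\<open>vpath\<close>: nonempty, distinct, consecutive vertices adjacent).
\<close>

definition grid_graph :: "nat \<Rightarrow> (nat \<times> nat) pair_pre_digraph" where
  "grid_graph m =
    \<lparr> pverts = {0..<m} \<times> {0..<m},
      parcs = {((x1, y1), (x2, y2)) | x1 y1 x2 y2.
        x1 < m \<and> y1 < m \<and> x2 < m \<and> y2 < m \<and>
        \<bar>int x1 - int x2\<bar> + \<bar>int y1 - int y2\<bar> = 1} \<rparr>"

text \<open>
  The vertices of a path are distinct, so the number of occurrences of a color on a path \<open>p\<close>
  is the number of elements of \<open>set p\<close> with that color.
\<close>

definition um_coloring :: "('a, 'b) pre_digraph \<Rightarrow> nat \<Rightarrow> ('a \<Rightarrow> nat) \<Rightarrow> bool" where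
  "um_coloring G k c \<longleftrightarrow>
    c \<in> verts G \<rightarrow> {1..k} \<and>
    (\<forall>p. vpath p G \<longrightarrow> (\<exists>!v. v \<in> set p \<and> c v = Max (c ` set p)))"

definition cf_coloring :: "('a, 'b) pre_digraph \<Rightarrow> nat \<Rightarrow> ('a \<Rightarrow> nat) \<Rightarrow> bool" where
  "cf_coloring G k c \<longleftrightarrow>
    c \<in> verts G \<rightarrow> {1..k} \<and>
    (\<forall>p. vpath p G \<longrightarrow> (\<exists>i. \<exists>!v. v \<in> set p \<and> c v = i))"

definition chi_um :: "('a, 'b) pre_digraph \<Rightarrow> nat" where
  "chi_um G = (LEAST k. \<exists>c. um_coloring G k c)"

definition chi_cf :: "('a, 'b) pre_digraph \<Rightarrow> nat" where
  "chi_cf G = (LEAST k. \<exists>c. cf_coloring G k c)"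

lemma um_coloring_imp_cf_coloring: "um_coloring G k c \<Longrightarrow> cf_coloring G k c"
  unfolding um_coloring_def cf_coloring_def by blast

text \<open>On finite graphs both minima range over nonempty sets, hence are attained.\<close>

lemma um_coloring_exists:
  assumes "finite (verts G)"
  shows "\<exists>k c. um_coloring G k c"
proof -
  obtain f :: "'a \<Rightarrow> nat" and n where f: "f ` verts G = {i. i < n}" "inj_on f (verts G)"
    using finite_imp_inj_to_nat_seg[OF assms] by blast
  have "\<exists>!v. v \<in> set p \<and> Suc (f v) = Max ((\<lambda>v. Suc (f v)) ` set p)" if "vpath p G" for p
  proof -
    have sub: "set p \<subseteq> verts G" and ne: "p \<noteq> []"
      using that by (auto simp: vpath_def vwalk_def)
    have "Max ((\<lambda>v. Suc (f v)) ` set p) \<in> (\<lambda>v. Suc (f v)) ` set p"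
      using ne by (intro Max_in) auto
    then obtain v where "v \<in> set p" "Suc (f v) = Max ((\<lambda>v. Suc (f v)) ` set p)"
      by auto
    moreover have "u = w" if "u \<in> set p" "w \<in> set p" "Suc (f u) = Suc (f w)" for u w
      using that sub f(2) by (auto dest: inj_onD)
    ultimately show ?thesis by metis
  qed
  moreover have "(\<lambda>v. Suc (f v)) \<in> verts G \<rightarrow> {1..n}"
    using f(1) by (auto simp: Suc_le_eq)
  ultimately show ?thesis
    unfolding um_coloring_def by blast
qed

lemma chi_um_attained:
  assumes "finite (verts G)"
  shows "\<exists>c. um_coloring G (chi_um G) c"
  unfolding chi_um_def by (rule LeastI_ex) (rule um_coloring_exists[OF assms])

lemma chi_cf_attained:
  assumes "finite (verts G)"
  shows "\<exists>c. cf_coloring G (chi_cf G) c"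
  unfolding chi_cf_def
  by (rule LeastI_ex) (use um_coloring_exists[OF assms] um_coloring_imp_cf_coloring in blast)

lemma pair_graph_grid_graph: "pair_graph (grid_graph m)"
proof -
  have "finite (parcs (grid_graph m))"
    by (rule finite_subset[of _ "({0..<m} \<times> {0..<m}) \<times> ({0..<m} \<times> {0..<m})"])
      (auto simp: grid_graph_def)
  then show ?thesis
    by unfold_locales (auto simp: grid_graph_def symmetric_def intro!: symI)
qed

end

theory Submission
  imports Defs
begin

text \<open>
  Split the grid into \<open>2 \<times> 2\<close> blocks, one for each vertex of the grid of half the size. The
  cells of a connected set of blocks have a Hamiltonian cycle, running around a spanning
  tree of the set. Hence in a conflict-free coloring every connected set of blocks has a color
  that occurs on exactly one of its cells. Removing the block of this cell from each component
  leaves components with fewer colors, so recursion on the number of colors, with the removed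
  blocks receiving the largest color, gives a unique-maximum coloring of the blocks.
\<close>

section \<open>Connected sets and unique-maximum colorings\<close>

text \<open>Connectedness of the subgraph that \<open>C\<close> induces, stated for a bare relation
  so that the recursion can pass to vertex subsets without forming subgraphs. The empty set counts
  as connected.\<close>

definition connected_in :: "('a \<times> 'a) set \<Rightarrow> 'a set \<Rightarrow> bool" where
  "connected_in E C \<longleftrightarrow> (\<forall>u\<in>C. \<forall>v\<in>C. (u, v) \<in> (E \<inter> C \<times> C)\<^sup>*)"

lemma connected_in_component:
  assumes "sym E" "v \<in> S"
  shows "connected_in E {w. (v, w) \<in> (E \<inter> S \<times> S)\<^sup>*}" (is "connected_in E ?C")
proof -
  have *: "(v, w) \<in> (E \<inter> ?C \<times> ?C)\<^sup>*" if "(v, w) \<in> (E \<inter> S \<times> S)\<^sup>*" for w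
    using that
  proof (induction rule: rtrancl_induct)
    case (step y z)
    then have "(y, z) \<in> E \<inter> ?C \<times> ?C" by (auto intro: rtrancl_into_rtrancl)
    with step.IH show ?case by (rule rtrancl_into_rtrancl)
  qed simp
  have "sym ((E \<inter> ?C \<times> ?C)\<^sup>*)"
    using assms(1) by (intro sym_rtrancl) (auto simp: sym_def)
  then show ?thesis
    unfolding connected_in_def by (metis (mono_tags, lifting) * mem_Collect_eq rtrancl_trans symD)
qed

text \<open>\<open>F v\<close> is the set of colors seen in \<open>v\<close>. Induction on
  \<open>k\<close>, with the colors counted on each connected set rather than on all of
  \<open>S\<close>: different components may lose different colors, so the count on \<open>S\<close>
  need not drop.\<close>

lemma unique_max_from_unique_colors:
  assumes "sym E"
    and "\<And>v. v \<in> S \<Longrightarrow> finite (F v)" and "finite S"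
    and "\<And>C. \<lbrakk>C \<subseteq> S; C \<noteq> {}; connected_in E C\<rbrakk> \<Longrightarrow>
      \<exists>b\<in>C. \<exists>i\<in>F b. \<forall>b'\<in>C. i \<in> F b' \<longrightarrow> b' = b"
    and "\<And>C. \<lbrakk>C \<subseteq> S; connected_in E C\<rbrakk> \<Longrightarrow> card (\<Union>(F ` C)) \<le> k"
  shows "\<exists>c. c \<in> S \<rightarrow> {1..k} \<and> (\<forall>P\<subseteq>S. P \<noteq> {} \<longrightarrow> connected_in E P \<longrightarrow>
    (\<exists>!v. v \<in> P \<and> c v = Max (c ` P)))"
  using assms(2-)
proof (induction k arbitrary: S)
  case 0
  \<comment> \<open>A singleton is connected, so its color set has an element, whereas the bound 0
    together with finiteness makes it empty.\<close>
  have "S = {}"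
  proof (rule ccontr)
    assume "S \<noteq> {}"
    then obtain v where v: "v \<in> S" by blast
    have conn: "connected_in E {v}" by (simp add: connected_in_def)
    with 0(3)[of "{v}"] v have "F v \<noteq> {}" by auto
    moreover have "card (\<Union>(F ` {v})) \<le> 0" using v conn by (intro 0(4)) auto
    ultimately show False using 0(1)[OF v] by simp
  qed
  then show ?case by auto
next
  case (Suc k)
  define comp where "comp v = {w. (v, w) \<in> (E \<inter> S \<times> S)\<^sup>*}" for v
  have symS: "sym ((E \<inter> S \<times> S)\<^sup>*)"
    using assms(1) by (intro sym_rtrancl) (auto simp: sym_def)
  have comp_sub: "comp v \<subseteq> S" if "v \<in> S" for v
    using that by (auto simp: comp_def elim: rtranclE)
  have comp_refl: "v \<in> comp v" for v by (simp add: comp_def)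
  have comp_eq: "comp w = comp v" if "w \<in> comp v" for v w
    using that symS unfolding comp_def
    by (auto intro: rtrancl_trans dest: symD)
  have comp_conn: "connected_in E (comp v)" if "v \<in> S" for v
    unfolding comp_def using assms(1) that by (rule connected_in_component)
  have sub_comp: "P \<subseteq> comp v" if "P \<subseteq> S" "connected_in E P" "v \<in> P" for P v
  proof
    fix w assume "w \<in> P"
    with that have "(v, w) \<in> (E \<inter> P \<times> P)\<^sup>*" by (simp add: connected_in_def)
    moreover have "(E \<inter> P \<times> P)\<^sup>* \<subseteq> (E \<inter> S \<times> S)\<^sup>*"
      using that(1) by (intro rtrancl_mono) auto
    ultimately show "w \<in> comp v" by (auto simp: comp_def)
  qed
  define uniq where "uniq C b \<longleftrightarrow> b \<in> C \<and> (\<exists>i\<in>F b. \<forall>b'\<in>C. i \<in> F b' \<longrightarrow> b' = b)" for C b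
  \<comment> \<open>The choice depends only on the component as a set, so all vertices of a
    component share one root.\<close>
  define root where "root C = (SOME b. uniq C b)" for C
  have root: "uniq (comp v) (root (comp v))" if "v \<in> S" for v
  proof -
    have "\<exists>b. uniq (comp v) b"
      unfolding uniq_def
      using Suc.prems(3)[of "comp v"] comp_sub[OF that] comp_conn[OF that] comp_refl by blast
    then show ?thesis unfolding root_def by (rule someI_ex)
  qed
  define T where "T = {v \<in> S. v = root (comp v)}"
  have root_T: "root (comp v) \<in> T" if "v \<in> S" for v
    using root[OF that] comp_sub[OF that] comp_eq[of "root (comp v)" v]
    by (auto simp: T_def uniq_def)
  \<comment> \<open>\<open>C\<close> lies in a single component and misses its root, hence misses
    the color \<open>i\<close> that only the root has there.\<close>
  have "card (\<Union>(F ` C)) \<le> k" if C: "C \<subseteq> S - T" "connected_in E C" for C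
  proof (cases "C = {}")
    case False
    then obtain v where v: "v \<in> C" by blast
    then have "v \<in> S" using C by blast
    let ?D = "comp v" and ?b = "root (comp v)"
    have CD: "C \<subseteq> ?D" using sub_comp[of C v] C v by blast
    have b: "?b \<notin> C" using root_T[OF \<open>v \<in> S\<close>] C by blast
    obtain i where i: "i \<in> F ?b" "\<forall>b'\<in>?D. i \<in> F b' \<longrightarrow> b' = ?b" and bD: "?b \<in> ?D"
      using root[OF \<open>v \<in> S\<close>] unfolding uniq_def by blast
    have "i \<notin> \<Union>(F ` C)" using i(2) CD b by blast
    moreover have "i \<in> \<Union>(F ` ?D)" using i(1) bD by blast
    ultimately have "\<Union>(F ` C) \<subset> \<Union>(F ` ?D)" using CD by blast
    moreover have "finite (\<Union>(F ` ?D))"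
      using comp_sub[OF \<open>v \<in> S\<close>] Suc.prems(1,2) by (meson finite_UN_I finite_subset subsetD)
    ultimately have "card (\<Union>(F ` C)) < card (\<Union>(F ` ?D))" by (rule psubset_card_mono[rotated])
    also have "\<dots> \<le> Suc k" using comp_sub comp_conn \<open>v \<in> S\<close> by (intro Suc.prems(4))
    finally show ?thesis by simp
  qed simp
  then have "\<exists>c. c \<in> S - T \<rightarrow> {1..k} \<and> (\<forall>P\<subseteq>S - T. P \<noteq> {} \<longrightarrow> connected_in E P \<longrightarrow>
    (\<exists>!v. v \<in> P \<and> c v = Max (c ` P)))"
    using Suc.prems(1-3) by (intro Suc.IH) auto
  then obtain c where c: "c \<in> S - T \<rightarrow> {1..k}"
    and um: "\<And>P. \<lbrakk>P \<subseteq> S - T; P \<noteq> {}; connected_in E P\<rbrakk> \<Longrightarrow>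
      \<exists>!v. v \<in> P \<and> c v = Max (c ` P)" by blast
  define d where "d v = (if v \<in> T then Suc k else c v)" for v
  have d: "d \<in> S \<rightarrow> {1..Suc k}" using c by (fastforce simp: d_def)
  have d_less: "d v < Suc k" if "v \<in> S - T" for v
    using Pi_mem[OF c that] that by (simp add: d_def)
  have "\<exists>!v. v \<in> P \<and> d v = Max (d ` P)"
    if P: "P \<subseteq> S" "P \<noteq> {}" "connected_in E P" for P
  proof (cases "P \<inter> T = {}")
    case True
    then have dc: "d v = c v" if "v \<in> P" for v using that by (auto simp: d_def)
    then have "d ` P = c ` P" by (rule image_cong[OF refl])
    moreover have "P \<subseteq> S - T" using True P by blast
    ultimately show ?thesis using um[OF _ P(2,3)] dc by metis
  next
    case False
    then obtain b where b: "b \<in> P" "b \<in> T" by blast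
    \<comment> \<open>\<open>P\<close> lies in one component, which has only one root, so
      \<open>Suc k\<close> occurs once on \<open>P\<close>.\<close>
    have *: "w = b" if "w \<in> P" "w \<in> T" for w
      using sub_comp[OF P(1,3) b(1)] comp_eq[of w b] that b(2) by (auto simp: T_def)
    have fin: "finite (d ` P)" using P(1) Suc.prems(2) finite_subset by blast
    have "Max (d ` P) = Suc k"
    proof (rule Max_eqI)
      show "Suc k \<in> d ` P" using b by (auto simp: d_def intro!: image_eqI[of _ _ b])
    qed (use fin d P(1) in fastforce)+
    then show ?thesis
      using b * d_less P(1) by (metis DiffI d_def less_irrefl subsetD)
  qed
  with d show ?case by blast
qed

section \<open>Arcs of walks and of cyclic lists\<close>

lemma vwalk_arcs_append_Cons:
  "vwalk_arcs (p @ x # q) = vwalk_arcs (p @ [x]) @ vwalk_arcs (x # q)"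
  by (cases "p = []"; cases "q = []") (simp_all add: vwalk_arcs_append)

lemma mem_vwalk_arcs_split:
  "(u, w) \<in> set (vwalk_arcs p) \<Longrightarrow> \<exists>as bs. p = as @ u # w # bs"
proof (induction p rule: vwalk_arcs.induct)
  case (3 x y xs)
  then consider "u = x" "w = y" | "(u, w) \<in> set (vwalk_arcs (y # xs))" by auto
  then show ?case
  proof cases
    case 1
    then show ?thesis by (metis append_Nil)
  next
    case 2
    with 3 show ?thesis by (metis append_Cons)
  qed
qed auto

text \<open>Turns paths into connected sets, the form in which the coloring result applies to them.
  By induction every vertex of the walk is reachable from its second vertex
  \<open>y\<close>.\<close>

lemma connected_in_vwalk_arcs:
  assumes "sym E" "set (vwalk_arcs p) \<subseteq> E"
  shows "connected_in E (set p)"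
  using assms(2)
proof (induction p rule: vwalk_arcs.induct)
  case (3 x y xs)
  let ?R = "\<lambda>A. E \<inter> A \<times> A"
  let ?P = "set (x # y # xs)"
  have sym: "sym ((?R ?P)\<^sup>*)" using assms(1) by (intro sym_rtrancl) (auto simp: sym_def)
  have "(?R (set (y # xs)))\<^sup>* \<subseteq> (?R ?P)\<^sup>*" by (intro rtrancl_mono) auto
  with 3 have "(y, v) \<in> (?R ?P)\<^sup>*" if "v \<in> set (y # xs)" for v
    using that by (auto simp: connected_in_def)
  moreover have "(y, x) \<in> (?R ?P)\<^sup>*" using 3(2) assms(1) by (auto dest: symD)
  ultimately have *: "(y, v) \<in> (?R ?P)\<^sup>*" if "v \<in> ?P" for v using that by auto
  show ?case
    unfolding connected_in_def
  proof (intro ballI)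
    fix u v assume "u \<in> ?P" "v \<in> ?P"
    then show "(u, v) \<in> (?R ?P)\<^sup>*" using symD[OF sym *] * by (blast intro: rtrancl_trans)
  qed
qed (auto simp: connected_in_def)

text \<open>The list names each vertex of the cycle once, so \<open>distinct\<close> applies to it
  directly; the appended head supplies the closing arc.\<close>

definition cycle_arcs :: "'a list \<Rightarrow> ('a \<times> 'a) set" where
  "cycle_arcs xs = set (vwalk_arcs (xs @ [hd xs]))"

text \<open>The arc from \<open>u\<close> to \<open>w\<close> is replaced by a detour through
  \<open>zs\<close>. No other arc is lost, and only arcs of the detour are new.\<close>

lemma cycle_insert:
  assumes "xs \<noteq> []" "(u, w) \<in> cycle_arcs xs"
  obtains ys where "ys \<noteq> []" "distinct ys \<longleftrightarrow> distinct (xs @ zs)" "set ys = set xs \<union> set zs"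
    "cycle_arcs ys \<subseteq> cycle_arcs xs \<union> set (vwalk_arcs (u # zs @ [w]))"
    "cycle_arcs xs - {(u, w)} \<union> set (vwalk_arcs (u # zs @ [w])) \<subseteq> cycle_arcs ys"
proof -
  obtain as bs where split: "xs @ [hd xs] = as @ u # w # bs"
    using assms(2) mem_vwalk_arcs_split unfolding cycle_arcs_def by fast
  have "\<exists>ys. ys @ [hd ys] = as @ u # zs @ w # bs \<and> ys \<noteq> [] \<and>
    (distinct ys \<longleftrightarrow> distinct (xs @ zs)) \<and> set ys = set xs \<union> set zs"
  proof (cases bs rule: rev_cases)
    \<comment> \<open>Here the arc is the closing one, from the last vertex back to the head, so
      \<open>zs\<close> goes at the end of the list.\<close>
    case Nil
    with split have "xs = as @ [u]" "hd xs = w" by auto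
    then show ?thesis using Nil
      by (intro exI[of _ "as @ u # zs"]) (auto simp: hd_append split: if_splits)
  next
    case (snoc cs e)
    with split have "xs = as @ u # w # cs" "hd xs = e" by auto
    then show ?thesis using snoc
      by (intro exI[of _ "as @ u # zs @ w # cs"]) (auto simp: hd_append split: if_splits)
  qed
  then obtain ys where ys: "ys @ [hd ys] = as @ u # zs @ w # bs" "ys \<noteq> []"
    "distinct ys \<longleftrightarrow> distinct (xs @ zs)" "set ys = set xs \<union> set zs" by blast
  have "cycle_arcs xs = set (vwalk_arcs (as @ [u])) \<union> {(u, w)} \<union> set (vwalk_arcs (w # bs))"
    unfolding cycle_arcs_def split by (subst vwalk_arcs_append_Cons) auto
  moreover have "cycle_arcs ys = set (vwalk_arcs (as @ [u])) \<union>
      set (vwalk_arcs (u # zs @ [w])) \<union> set (vwalk_arcs (w # bs))"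
    unfolding cycle_arcs_def ys(1)
    using vwalk_arcs_append_Cons[of as u "zs @ w # bs"] vwalk_arcs_append_Cons[of "u # zs" w bs]
    by auto
  ultimately show ?thesis using that[OF ys(2-4)] by blast
qed

section \<open>Tours through the cells of a set of blocks\<close>

text \<open>Adjacency on the whole quadrant, used for blocks and cells alike; the bound
  \<open>m\<close> enters only when tours become paths of the grid graph.\<close>

definition grid_adj :: "((nat \<times> nat) \<times> nat \<times> nat) set" where
  "grid_adj = {((x1, y1), (x2, y2)). \<bar>int x1 - int x2\<bar> + \<bar>int y1 - int y2\<bar> = 1}"

lemma sym_grid_adj: "sym grid_adj"
  by (auto simp: sym_def grid_adj_def)

lemma grid_adj_cases:
  assumes "(u, w) \<in> grid_adj"
  obtains (right) x y where "u = (x, y)" "w = (Suc x, y)"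
  | (left) x y where "u = (Suc x, y)" "w = (x, y)"
  | (up) x y where "u = (x, y)" "w = (x, Suc y)"
  | (down) x y where "u = (x, Suc y)" "w = (x, y)"
proof -
  obtain a b c d where uw: "u = (a, b)" "w = (c, d)" by (metis surj_pair)
  with assms have "c = Suc a \<and> d = b \<or> a = Suc c \<and> d = b \<or> c = a \<and> d = Suc b \<or> c = a \<and> b = Suc d"
    by (auto simp: grid_adj_def)
  with uw that show thesis by blast
qed

definition cells :: "(nat \<times> nat) set \<Rightarrow> (nat \<times> nat) set" where
  "cells S = {(i, j). (i div 2, j div 2) \<in> S}"

text \<open>
  The counterclockwise sides of blocks that face a block outside of \<open>S\<close> but inside the
  quadrant; a cycle around a spanning tree of \<open>S\<close> traverses all of them.
\<close>

definition free_sides :: "(nat \<times> nat) set \<Rightarrow> ((nat \<times> nat) \<times> nat \<times> nat) set" where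
  "free_sides S =
    {((2*x+1, 2*y), (2*x+1, 2*y+1)) | x y. (x, y) \<in> S \<and> (Suc x, y) \<notin> S} \<union>
    {((2*x+2, 2*y+1), (2*x+2, 2*y)) | x y. (Suc x, y) \<in> S \<and> (x, y) \<notin> S} \<union>
    {((2*x+1, 2*y+1), (2*x, 2*y+1)) | x y. (x, y) \<in> S \<and> (x, Suc y) \<notin> S} \<union>
    {((2*x, 2*y+2), (2*x+1, 2*y+2)) | x y. (x, Suc y) \<in> S \<and> (x, y) \<notin> S}"

text \<open>The last conjunct is the invariant that lets a tour grow: a Hamiltonian cycle alone need
  not use the side at which the next block is to be attached.\<close>

definition tour :: "(nat \<times> nat) set \<Rightarrow> (nat \<times> nat) list \<Rightarrow> bool" where
  "tour S xs \<longleftrightarrow> xs \<noteq> [] \<and> distinct xs \<and> set xs = cells S \<and>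
    cycle_arcs xs \<subseteq> grid_adj \<and> free_sides S \<subseteq> cycle_arcs xs"

lemma cells_singleton:
  "cells {(x, y)} = {(2*x, 2*y), (2*x+1, 2*y), (2*x+1, 2*y+1), (2*x, 2*y+1)}"
proof (rule set_eqI)
  fix p :: "nat \<times> nat"
  obtain i j where p: "p = (i, j)" by (cases p)
  have "i div 2 = x \<longleftrightarrow> i = 2*x \<or> i = 2*x+1" "j div 2 = y \<longleftrightarrow> j = 2*y \<or> j = 2*y+1"
    by linarith+
  then show "p \<in> cells {(x, y)} \<longleftrightarrow>
      p \<in> {(2*x, 2*y), (2*x+1, 2*y), (2*x+1, 2*y+1), (2*x, 2*y+1)}"
    unfolding p cells_def mem_Collect_eq prod.case insert_iff empty_iff prod.inject by blast
qed

lemma tour_singleton: "tour {(x, y)} [(2*x, 2*y), (2*x+1, 2*y), (2*x+1, 2*y+1), (2*x, 2*y+1)]"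
  unfolding tour_def
proof (intro conjI)
qed (auto simp: cells_singleton cycle_arcs_def grid_adj_def free_sides_def)

text \<open>A side that becomes free belongs to the new block, and the neighbor across it is outside
  \<open>S\<close>. The left and lower cases quantify over a predecessor to avoid subtraction; the
  condition is vacuous at the border of the quadrant.\<close>

lemma free_sides_insert_cases:
  assumes "e \<in> free_sides (insert (x, y) S)"
  obtains "e \<in> free_sides S"
  | "e = ((2*x+1, 2*y), (2*x+1, 2*y+1))" "(Suc x, y) \<notin> S"
  | "e = ((2*x, 2*y+1), (2*x, 2*y))" "\<And>a. x = Suc a \<Longrightarrow> (a, y) \<notin> S"
  | "e = ((2*x+1, 2*y+1), (2*x, 2*y+1))" "(x, Suc y) \<notin> S"
  | "e = ((2*x, 2*y), (2*x+1, 2*y))" "\<And>b. y = Suc b \<Longrightarrow> (x, b) \<notin> S"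
proof -
  from assms consider
    a b where "e = ((2*a+1, 2*b), (2*a+1, 2*b+1))" "(a, b) \<in> insert (x, y) S" "(Suc a, b) \<notin> S"
  | a b where "e = ((2*a+2, 2*b+1), (2*a+2, 2*b))" "(Suc a, b) \<in> insert (x, y) S" "(a, b) \<notin> S"
  | a b where "e = ((2*a+1, 2*b+1), (2*a, 2*b+1))" "(a, b) \<in> insert (x, y) S" "(a, Suc b) \<notin> S"
  | a b where "e = ((2*a, 2*b+2), (2*a+1, 2*b+2))" "(a, Suc b) \<in> insert (x, y) S" "(a, b) \<notin> S"
    unfolding free_sides_def by blast
  then show thesis
  proof cases
    case 1
    then show thesis using that(1,2) by (cases "(a, b) = (x, y)") (auto simp: free_sides_def)
  next
    case 2
    then show thesis using that(1,3) by (cases "(Suc a, b) = (x, y)") (auto simp: free_sides_def)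
  next
    case 3
    then show thesis using that(1,4) by (cases "(a, b) = (x, y)") (auto simp: free_sides_def)
  next
    case 4
    then show thesis using that(1,5) by (cases "(a, Suc b) = (x, y)") (auto simp: free_sides_def)
  qed
qed

text \<open>The part common to all four directions: the side from \<open>u\<close> to
  \<open>w\<close> gives way to a detour through the cells of \<open>b\<close>. Losing this side is
  harmless, since it is no longer free once \<open>b\<close> is inserted.\<close>

lemma tour_extend:
  assumes t: "tour S xs" and "(u, w) \<in> free_sides S" "(u, w) \<notin> free_sides (insert b S)"
    and sides: "free_sides (insert b S) \<subseteq> free_sides S \<union> set (vwalk_arcs (u # zs @ [w]))"
    and zs: "set zs = cells {b}" "distinct zs" and "b \<notin> S"
    and adj: "set (vwalk_arcs (u # zs @ [w])) \<subseteq> grid_adj"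
  shows "\<exists>ys. tour (insert b S) ys"
proof -
  from t have xs: "xs \<noteq> []" "distinct xs" "set xs = cells S" "cycle_arcs xs \<subseteq> grid_adj"
    "free_sides S \<subseteq> cycle_arcs xs" by (auto simp: tour_def)
  then have "(u, w) \<in> cycle_arcs xs" using assms(2) by blast
  from cycle_insert[OF xs(1) this] obtain ys where ys: "ys \<noteq> []"
    "distinct ys \<longleftrightarrow> distinct (xs @ zs)" "set ys = set xs \<union> set zs"
    "cycle_arcs ys \<subseteq> cycle_arcs xs \<union> set (vwalk_arcs (u # zs @ [w]))"
    "cycle_arcs xs - {(u, w)} \<union> set (vwalk_arcs (u # zs @ [w])) \<subseteq> cycle_arcs ys"
    by metis
  have cells: "cells S \<inter> cells {b} = {}" "cells (insert b S) = cells S \<union> cells {b}"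
    using \<open>b \<notin> S\<close> by (auto simp: cells_def)
  have "distinct ys" "set ys = cells (insert b S)" using ys xs zs cells by auto
  moreover have "cycle_arcs ys \<subseteq> grid_adj" using ys(4) xs(4) adj by blast
  moreover have "free_sides (insert b S) \<subseteq> cycle_arcs ys"
    using sides assms(3) xs(5) ys(5) by blast
  ultimately show ?thesis using ys(1) unfolding tour_def by blast
qed

text \<open>The side of block \<open>u\<close> facing \<open>b\<close> is free, so the tour uses it.
  It is replaced by a detour along the other three sides of \<open>b\<close>, again
  counterclockwise. The four directions are rotations of one another.\<close>

lemma tour_insert:
  assumes t: "tour S xs" and "u \<in> S" "b \<notin> S" and "(u, b) \<in> grid_adj"
  shows "\<exists>ys. tour (insert b S) ys"
  using assms(4)
proof (cases rule: grid_adj_cases)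
  case (right x y)
  let ?u = "(2*x+1, 2*y)" and ?w = "(2*x+1, 2*y+1)" and ?b = "(Suc x, y)"
  \<comment> \<open>The cells of the new block from the neighbor of \<open>?u\<close> round to the
    neighbor of \<open>?w\<close>, along its lower, right and upper sides.\<close>
  let ?zs = "[(2*x+2, 2*y), (2*x+3, 2*y), (2*x+3, 2*y+1), (2*x+2, 2*y+1)]"
  have side: "(?u, ?w) \<in> free_sides S" using right assms(2,3) by (auto simp: free_sides_def)
  have inner: "(?u, ?w) \<notin> free_sides (insert ?b S)"
    using right assms(2) by (simp add: free_sides_def)
  \<comment> \<open>The detour omits only the left side of the new block, which faces a block of
    \<open>S\<close> and is not free.\<close>
  have free: "free_sides (insert ?b S) \<subseteq> free_sides S \<union> set (vwalk_arcs (?u # ?zs @ [?w]))"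
    using right assms(2) by (intro subsetI, elim free_sides_insert_cases) simp_all
  have cells: "set ?zs = cells {?b}" by (auto simp: cells_singleton)
  show ?thesis
    unfolding right(2)
    by (rule tour_extend[OF t side inner free cells])
      (use right assms(3) in \<open>auto simp: grid_adj_def\<close>)
next
  case (left x y)
  let ?u = "(2*x+2, 2*y+1)" and ?w = "(2*x+2, 2*y)" and ?b = "(x, y)"
  let ?zs = "[(2*x+1, 2*y+1), (2*x, 2*y+1), (2*x, 2*y), (2*x+1, 2*y)]"
  have side: "(?u, ?w) \<in> free_sides S" using left assms(2,3) by (auto simp: free_sides_def)
  have inner: "(?u, ?w) \<notin> free_sides (insert ?b S)"
    using left assms(2) by (simp add: free_sides_def)
  have free: "free_sides (insert ?b S) \<subseteq> free_sides S \<union> set (vwalk_arcs (?u # ?zs @ [?w]))"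
    using left assms(2) by (intro subsetI, elim free_sides_insert_cases) simp_all
  have cells: "set ?zs = cells {?b}" by (auto simp: cells_singleton)
  show ?thesis
    unfolding left(2)
    by (rule tour_extend[OF t side inner free cells])
      (use left assms(3) in \<open>auto simp: grid_adj_def\<close>)
next
  case (up x y)
  let ?u = "(2*x+1, 2*y+1)" and ?w = "(2*x, 2*y+1)" and ?b = "(x, Suc y)"
  let ?zs = "[(2*x+1, 2*y+2), (2*x+1, 2*y+3), (2*x, 2*y+3), (2*x, 2*y+2)]"
  have side: "(?u, ?w) \<in> free_sides S" using up assms(2,3) by (auto simp: free_sides_def)
  have inner: "(?u, ?w) \<notin> free_sides (insert ?b S)"
    using up assms(2) by (simp add: free_sides_def)
  have free: "free_sides (insert ?b S) \<subseteq> free_sides S \<union> set (vwalk_arcs (?u # ?zs @ [?w]))"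
    using up assms(2) by (intro subsetI, elim free_sides_insert_cases) simp_all
  have cells: "set ?zs = cells {?b}" by (auto simp: cells_singleton)
  show ?thesis
    unfolding up(2)
    by (rule tour_extend[OF t side inner free cells])
      (use up assms(3) in \<open>auto simp: grid_adj_def\<close>)
next
  case (down x y)
  let ?u = "(2*x, 2*y+2)" and ?w = "(2*x+1, 2*y+2)" and ?b = "(x, y)"
  let ?zs = "[(2*x, 2*y+1), (2*x, 2*y), (2*x+1, 2*y), (2*x+1, 2*y+1)]"
  have side: "(?u, ?w) \<in> free_sides S" using down assms(2,3) by (auto simp: free_sides_def)
  have inner: "(?u, ?w) \<notin> free_sides (insert ?b S)"
    using down assms(2) by (simp add: free_sides_def)
  have free: "free_sides (insert ?b S) \<subseteq> free_sides S \<union> set (vwalk_arcs (?u # ?zs @ [?w]))"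
    using down assms(2) by (intro subsetI, elim free_sides_insert_cases) simp_all
  have cells: "set ?zs = cells {?b}" by (auto simp: cells_singleton)
  show ?thesis
    unfolding down(2)
    by (rule tour_extend[OF t side inner free cells])
      (use down assms(3) in \<open>auto simp: grid_adj_def\<close>)
qed

text \<open>A walk inside \<open>C\<close> from a point of \<open>T\<close> to a point of
  \<open>C - T\<close> has a step that leaves \<open>T\<close>.\<close>

lemma connected_in_boundary:
  assumes "connected_in E C" "T \<subset> C" "T \<noteq> {}"
  obtains u w where "u \<in> T" "w \<in> C - T" "(u, w) \<in> E"
proof -
  obtain a b where ab: "a \<in> T" "b \<in> C - T" using assms by blast
  then have "(a, b) \<in> (E \<inter> C \<times> C)\<^sup>*" using assms by (auto simp: connected_in_def)
  then have "b \<notin> T \<longrightarrow> (\<exists>u\<in>T. \<exists>w\<in>C - T. (u, w) \<in> E)"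
    by (induction rule: rtrancl_induct) (use ab in auto)
  then show thesis using ab that by blast
qed

text \<open>The spanning tree stays implicit: a maximal subset of \<open>C\<close> with a tour is
  all of \<open>C\<close>, because otherwise an adjacent block of \<open>C\<close> could be attached
  to it.\<close>

lemma connected_has_tour:
  assumes "finite C" "C \<noteq> {}" "connected_in grid_adj C"
  shows "\<exists>xs. tour C xs"
proof -
  define good where "good T \<longleftrightarrow> T \<subseteq> C \<and> T \<noteq> {} \<and> (\<exists>xs. tour T xs)" for T
  obtain x y where "(x, y) \<in> C" using assms(2) by auto
  then have "good {(x, y)}" using tour_singleton by (auto simp: good_def)
  moreover have "finite (Collect good)"
    by (rule finite_subset[of _ "Pow C"]) (use assms(1) in \<open>auto simp: good_def\<close>)
  ultimately obtain T where T: "good T" and max: "\<And>T'. \<lbrakk>good T'; T \<subseteq> T'\<rbrakk> \<Longrightarrow> T' = T"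
    by (metis empty_iff finite_has_maximal mem_Collect_eq)
  have "T = C"
  proof (rule ccontr)
    assume "T \<noteq> C"
    then have "T \<subset> C" "T \<noteq> {}" using T by (auto simp: good_def)
    then obtain u w where uw: "u \<in> T" "w \<in> C - T" "(u, w) \<in> grid_adj"
      by (rule connected_in_boundary[OF assms(3)])
    then have "good (insert w T)" using T tour_insert unfolding good_def by blast
    then show False using max[of "insert w T"] uw(2) by blast
  qed
  with T show ?thesis by (simp add: good_def)
qed

section \<open>Transfer to the grid graphs\<close>

lemma verts_grid_graph: "verts (with_proj (grid_graph m)) = {0..<m} \<times> {0..<m}"
  by (simp add: grid_graph_def)

lemma arcs_ends_grid_graph:
  "arcs_ends (with_proj (grid_graph m)) =
    grid_adj \<inter> ({0..<m} \<times> {0..<m}) \<times> ({0..<m} \<times> {0..<m})"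
  by (auto simp: arcs_ends_def arc_to_ends_def grid_graph_def grid_adj_def)

lemma vwalk_arcs_subset: "set (vwalk_arcs p) \<subseteq> set p \<times> set p"
  by (induction p rule: vwalk_arcs.induct) auto

text \<open>Dropping the closing arc of the tour leaves a path.\<close>

lemma tour_vpath:
  assumes "tour C xs" "C \<subseteq> {0..<m div 2} \<times> {0..<m div 2}"
  shows "vpath xs (with_proj (grid_graph m))"
proof -
  \<comment> \<open>If \<open>i div 2 < m div 2\<close> then \<open>i < m\<close>; for odd
    \<open>m\<close> the last row and column of the grid remain uncovered.\<close>
  have "cells C \<subseteq> {0..<m} \<times> {0..<m}" using assms(2) by (fastforce simp: cells_def)
  then have sub: "set xs \<subseteq> {0..<m} \<times> {0..<m}" using assms(1) by (auto simp: tour_def)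
  moreover have "set (vwalk_arcs xs) \<subseteq> grid_adj"
    using assms(1) set_vwalk_arcs_append1[of xs "[hd xs]"] by (auto simp: tour_def cycle_arcs_def)
  ultimately have "set (vwalk_arcs xs) \<subseteq> arcs_ends (with_proj (grid_graph m))"
    using vwalk_arcs_subset[of xs] unfolding arcs_ends_grid_graph by blast
  then show ?thesis
    using assms(1) sub unfolding vpath_def vwalk_def verts_grid_graph tour_def by blast
qed

text \<open>Each block \<open>b\<close> carries the set \<open>F b\<close> of colors of its four
  cells. A color unique on a tour of \<open>C\<close> is then found in only one block of
  \<open>C\<close>, as the abstract coloring result requires.\<close>

lemma um_coloring_half_grid:
  assumes c: "cf_coloring (with_proj (grid_graph m)) k c"
  shows "\<exists>d. um_coloring (with_proj (grid_graph (m div 2))) k d"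
proof -
  let ?S = "{0..<m div 2} \<times> {0..<m div 2}"
  define F where "F b = c ` cells {b}" for b
  have F_sub: "F b \<subseteq> {1..k}" if "b \<in> ?S" for b
  proof -
    have "cells {b} \<subseteq> {0..<m} \<times> {0..<m}" using that by (fastforce simp: cells_def)
    then show ?thesis using c unfolding F_def cf_coloring_def verts_grid_graph by blast
  qed
  have "\<exists>d. d \<in> ?S \<rightarrow> {1..k} \<and> (\<forall>P\<subseteq>?S. P \<noteq> {} \<longrightarrow> connected_in grid_adj P \<longrightarrow>
    (\<exists>!v. v \<in> P \<and> d v = Max (d ` P)))"
  proof (rule unique_max_from_unique_colors[OF sym_grid_adj, where F = F])
    show "finite (F v)" if "v \<in> ?S" for v
      using F_sub[OF that] finite_subset by blast
  next
    fix C assume C: "C \<subseteq> ?S" "C \<noteq> {}" "connected_in grid_adj C"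
    then have "finite C" using finite_subset by blast
    then obtain xs where xs: "tour C xs" using connected_has_tour C by blast
    then obtain i where "\<exists>!v. v \<in> cells C \<and> c v = i"
      using c tour_vpath[OF xs C(1)] xs unfolding cf_coloring_def tour_def by metis
    then obtain v where v: "v \<in> cells C" "c v = i" and
      uniq: "\<And>w. \<lbrakk>w \<in> cells C; c w = i\<rbrakk> \<Longrightarrow> w = v" by blast
    \<comment> \<open>The block that contains the uniquely colored cell \<open>v\<close>.\<close>
    let ?b = "(fst v div 2, snd v div 2)"
    have b: "?b \<in> C" "v \<in> cells {?b}" using v by (auto simp: cells_def)
    have "b' = ?b" if b': "b' \<in> C" "i \<in> F b'" for b'
    proof -
      obtain w where w: "w \<in> cells {b'}" "c w = i" using b' by (auto simp: F_def)
      then have "w \<in> cells C" using b' by (auto simp: cells_def)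
      with uniq w have "w = v" by blast
      with w show ?thesis by (auto simp: cells_def)
    qed
    moreover have "i \<in> F ?b" using b v by (auto simp: F_def)
    ultimately show "\<exists>b\<in>C. \<exists>i\<in>F b. \<forall>b'\<in>C. i \<in> F b' \<longrightarrow> b' = b" using b by blast
  next
    fix C assume "C \<subseteq> ?S"
    then have "\<Union>(F ` C) \<subseteq> {1..k}" using F_sub by blast
    then show "card (\<Union>(F ` C)) \<le> k" using card_mono[of "{1..k}"] by fastforce
  qed simp
  then obtain d where d: "d \<in> ?S \<rightarrow> {1..k}" and um: "\<And>P. \<lbrakk>P \<subseteq> ?S; P \<noteq> {}; connected_in grid_adj P\<rbrakk>
    \<Longrightarrow> \<exists>!v. v \<in> P \<and> d v = Max (d ` P)" by blast
  have "\<exists>!v. v \<in> set p \<and> d v = Max (d ` set p)"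
    if "vpath p (with_proj (grid_graph (m div 2)))" for p
  proof -
    have "set p \<subseteq> ?S" "p \<noteq> []" "set (vwalk_arcs p) \<subseteq> grid_adj"
      using that unfolding vpath_def vwalk_def verts_grid_graph arcs_ends_grid_graph by auto
    then show ?thesis using um connected_in_vwalk_arcs[OF sym_grid_adj] by simp
  qed
  then show ?thesis using d unfolding um_coloring_def verts_grid_graph by blast
qed

theorem theorem3:
  fixes m :: nat
  assumes "m > 1"
  shows "chi_cf (with_proj (grid_graph m)) \<ge> chi_um (with_proj (grid_graph (m div 2)))"
proof -
  have "finite (verts (with_proj (grid_graph m)))" unfolding verts_grid_graph by simp
  then obtain c where "cf_coloring (with_proj (grid_graph m)) (chi_cf (with_proj (grid_graph m))) c"
    using chi_cf_attained by blast
  \<comment> \<open>The transferred coloring uses \<open>chi_cf\<close> many colors, so this number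
    is among those whose least element is \<open>chi_um\<close>.\<close>
  then show ?thesis unfolding chi_um_def by (intro Least_le um_coloring_half_grid)
qed

end
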